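(* Let $m,n,d\in\mathbb{N}_0$ such that $m\ge n\ge d$. Then $$\sum_{s=0}^n\sum_{t=0}^{d}(-1)^{s+t}\binom{m}{s}\binom{s}{t}\binom{2m-s}{n}^{-1}\binom{m-s}{d-t+m-n}\binom{m-s}{d-t}\frac{2m-2s+1}{2m-s+1}=\delta_{n,d}.$$
   Context: $\mathbb{N}_0=\{0,1,2,\dots\}$. $\delta_{n,d}=1$ if $n=d$ and $\delta_{n,d}=0$ otherwise. Binomial coefficients $\binom{a}{b}$ of non-negative integers are zero when $b>a$. *)

theory Defs
  imports Complex_Main
begin

end

theory Submission
  imports Defs "HOL-Analysis.Henstock_Kurzweil_Integration" "HOL-Computational_Algebra.Polynomial"
begin

text \<open>
  The idea is to turn the double sum into the integral over \<open>[0,1]\<close> of one explicit polynomial.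

  Put \<open>s = t + r\<close> and \<open>N = n - d\<close>. The binomials other than the inverted one collapse to
  \<open>(m choose d) (d choose t) (m-d choose r) (m-t-r choose N-r)\<close>, with sign \<open>(-1)^r\<close>, and the sum
  runs over the full rectangle \<open>t \<le> d\<close>, \<open>r \<le> N\<close>. The remaining factor depends on \<open>s\<close> only. It is
  a difference of two Beta integrals: for \<open>n \<ge> 1\<close> it equals the integral of
  \<open>v^(2m-n-s) (1-v)^(n-1) q(v)\<close> with the fixed linear polynomial
  \<open>q(v) = (2m+1) v - (2m+1-2n)\<close> (lemma \<open>has_integral_weight\<close>). Hence \<open>s\<close> enters the integrand only
  through a power of \<open>v\<close>, and the double sum under the integral is a coefficient of a generating
  polynomial: apart from the constant \<open>(m choose d)\<close>, the signed sum of the binomial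
  products times \<open>v^(n-s)\<close> is the coefficient of \<open>z^N\<close> in
  \<open>(1 + v + v^2 z)^d (1 - (1-v) z)^(m-d)\<close>. After multiplication by \<open>(1-v)^d\<close> the first factor is
  \<open>(1 - v^2 (1 - (1-v) z))^d\<close>, so everything expands in powers of \<open>1 - (1-v) z\<close> alone, and the double
  sum becomes a single alternating sum of even powers of \<open>v\<close> (lemma \<open>rescaled_generating_identity\<close>).

  If \<open>n > d\<close>, integrating termwise gives two alternating sums of reciprocals of rising
  factorials. These are finite differences with a closed form
  (lemma \<open>alternating_sum_inverse_pochhammer\<close>), and the two closed forms are equal, so the integral
  is \<open>0\<close>. If \<open>n = d\<close>, the integrand is the derivative of a polynomial vanishing at both end points
  plus a multiple of \<open>v^(2(m-d)+1) (1-v^2)^(d-1)\<close>, and its integral is the reciprocal of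
  \<open>(m choose d)\<close>, which cancels the constant factor. For \<open>n = 0\<close>
  the sum has the single term \<open>1\<close>.
\<close>

section \<open>The weight as an integral\<close>

lemma has_integral_beta_nat:
  "((\<lambda>v::real. v ^ a * (1 - v) ^ b) has_integral fact a * fact b / fact (a + b + 1)) {0..1}"
proof (induction b arbitrary: a)
  case 0
  have "((\<lambda>v::real. v ^ a) has_integral 1 ^ Suc a / real (Suc a) - 0 ^ Suc a / real (Suc a)) {0..1}"
  proof (rule fundamental_theorem_of_calculus)
    show "((\<lambda>v. v ^ Suc a / real (Suc a)) has_vector_derivative v ^ a) (at v within {0..1})" for v :: real
      using DERIV_cdivide[OF DERIV_pow[of "Suc a" v "{0..1}"], of "real (Suc a)"]
      by (simp add: has_real_derivative_iff_has_vector_derivative del: of_nat_Suc power_Suc)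
  qed simp
  moreover have "fact a * fact 0 / fact (a + 0 + 1) = 1 / real (Suc a)"
    by (simp add: divide_simps)
  ultimately show ?case by simp
next
  case (Suc b)
  have nz: "fact (a + b + 1) \<noteq> (0::real)" by simp
  have "((\<lambda>v::real. v ^ a * (1 - v) ^ b - v ^ Suc a * (1 - v) ^ b) has_integral
      fact a * fact b / fact (a + b + 1) - fact (Suc a) * fact b / fact (Suc a + b + 1)) {0..1}"
    by (intro has_integral_diff Suc.IH)
  also have "(\<lambda>v::real. v ^ a * (1 - v) ^ b - v ^ Suc a * (1 - v) ^ b) = (\<lambda>v. v ^ a * (1 - v) ^ Suc b)"
    by (auto simp: algebra_simps)
  also have "fact a * fact b / fact (a + b + 1) - fact (Suc a) * fact b / fact (Suc a + b + 1)
      = fact a * fact (Suc b) / (fact (a + Suc b + 1) :: real)"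
    by (simp add: divide_simps) (simp add: algebra_simps)
  finally show ?case .
qed

text \<open>
  With \<open>k = 2m-n-s\<close>, the two Beta integrals are \<open>k! (n-1)! / (k+n+1)!\<close> times \<open>k+1\<close> and
  \<open>k+n+1\<close>. The coefficients of the linear factor are chosen, independently of \<open>s\<close>, so that
  \<open>(2m+1) (k+1) - (2m+1-2n) (k+n+1) = n (2m-2s+1)\<close>. Lowering the exponent of \<open>1 - v\<close> to
  \<open>n - 1\<close>, rather than integrating \<open>(2m-2s+1) v^(2m-n-s) (1-v)^n\<close>, is what removes the factor
  \<open>2m-2s+1\<close> from the integrand.
\<close>

lemma has_integral_weight:
  fixes m n s :: nat
  assumes "1 \<le> n" "n \<le> m" "s \<le> n"
  shows "((\<lambda>v::real. v ^ (2 * m - n - s) * (1 - v) ^ (n - 1)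
            * ((2 * real m + 1) * v - (2 * real m + 1 - 2 * real n)))
          has_integral inverse (real ((2 * m - s) choose n))
            * (real (2 * m - 2 * s + 1) / real (2 * m - s + 1))) {0..1}"
proof -
  define k where "k = 2 * m - n - s"
  obtain b where n: "n = Suc b" using assms by (cases n) auto
  have k: "2 * m - s = k + n" "k + n + s = 2 * m" using assms by (auto simp: k_def)
  have m2: "2 * real m = real k + real n + real s" using k(2) by linarith
  have w: "inverse (real ((2 * m - s) choose n)) * (real (2 * m - 2 * s + 1) / real (2 * m - s + 1))
      = (2 * real m + 1) * (fact (Suc k) * fact b / fact (Suc k + b + 1))
        - (2 * real m + 1 - 2 * real n) * (fact k * fact b / fact (k + b + 1))"
  proof -
    have 1: "real ((k + n) choose n) = fact (k + b + 1) / (fact n * fact k)"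
      by (subst binomial_fact) (auto simp: n)
    have 2: "real (2 * m - 2 * s + 1) = real k + real n - real s + 1"
      using assms k by linarith
    show ?thesis unfolding k(1) 1 2 m2 unfolding n
      by (simp add: divide_simps) (simp add: algebra_simps)
  qed
  have "((\<lambda>v::real. (2 * real m + 1) * (v ^ Suc k * (1 - v) ^ b)
        - (2 * real m + 1 - 2 * real n) * (v ^ k * (1 - v) ^ b)) has_integral
        (2 * real m + 1) * (fact (Suc k) * fact b / fact (Suc k + b + 1))
        - (2 * real m + 1 - 2 * real n) * (fact k * fact b / fact (k + b + 1))) {0..1}"
    by (intro has_integral_diff has_integral_mult_right has_integral_beta_nat)
  then show ?thesis unfolding w
    unfolding k_def[symmetric] by (rule has_integral_eq[rotated]) (simp add: n algebra_simps)
qed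

section \<open>Alternating sums of reciprocal rising factorials\<close>

text \<open>
  The left side is, up to sign, the \<open>d\<close>-th finite difference of the reciprocal of a rising factorial,
  and one difference step only raises the length:
  \<open>1/(x)_K - 1/(x+1)_K = K/(x)_(K+1)\<close>. Pascal's rule makes this an induction on \<open>d\<close>.
\<close>

lemma alternating_sum_inverse_pochhammer:
  fixes x :: real
  assumes "x > 0"
  shows "(\<Sum>j\<le>d. (-1) ^ j * real (d choose j) / pochhammer (x + real j) K)
       = pochhammer (real K) d / pochhammer x (K + d)"
  using assms
proof (induction d arbitrary: x)
  case 0
  then show ?case by simp
next
  case (Suc d)
  let ?f = "\<lambda>j. 1 / pochhammer (x + real j) K"
  have split: "(\<Sum>j\<le>Suc d. (-1) ^ j * real (Suc d choose j) * ?f j)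
      = (\<Sum>j\<le>d. (-1) ^ j * real (d choose j) * ?f j)
        - (\<Sum>j\<le>d. (-1) ^ j * real (d choose j) * ?f (Suc j))"
  proof -
    have "(\<Sum>j\<le>Suc d. (-1) ^ j * real (Suc d choose j) * ?f j)
       = ?f 0 + (\<Sum>j\<le>d. (-1) ^ Suc j * real (Suc d choose Suc j) * ?f (Suc j))"
      by (subst sum.atMost_Suc_shift) simp
    also have "(\<Sum>j\<le>d. (-1) ^ Suc j * real (Suc d choose Suc j) * ?f (Suc j))
       = (\<Sum>j\<le>d. (-1) ^ Suc j * real (d choose Suc j) * ?f (Suc j))
        - (\<Sum>j\<le>d. (-1) ^ j * real (d choose j) * ?f (Suc j))"
      unfolding sum_subtractf[symmetric]
      by (rule sum.cong) (simp_all add: algebra_simps add_divide_distrib diff_divide_distrib)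
    also have "?f 0 + ((\<Sum>j\<le>d. (-1) ^ Suc j * real (d choose Suc j) * ?f (Suc j)) - (\<Sum>j\<le>d. (-1) ^ j * real (d choose j) * ?f (Suc j)))
       = (\<Sum>j\<le>Suc d. (-1) ^ j * real (d choose j) * ?f j) - (\<Sum>j\<le>d. (-1) ^ j * real (d choose j) * ?f (Suc j))"
      by (simp add: sum.atMost_Suc_shift del: sum.atMost_Suc)
    finally show ?thesis by simp
  qed
  have 1: "(\<Sum>j\<le>d. (-1) ^ j * real (d choose j) * ?f j) = pochhammer (real K) d / pochhammer x (K + d)"
    using Suc.IH[OF Suc.prems] by simp
  have 2: "(\<Sum>j\<le>d. (-1) ^ j * real (d choose j) * ?f (Suc j))
      = pochhammer (real K) d / pochhammer (x + 1) (K + d)"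
    using Suc.IH[of "x + 1"] Suc.prems by (simp add: add_ac)
  have pos: "pochhammer (x + 1) (K + d) > 0" "pochhammer x (K + d) > 0" "x > 0" "x + real (K + d) > 0"
    using Suc.prems by (auto intro!: pochhammer_pos)
  have p: "x * pochhammer (x + 1) (K + d) = pochhammer x (K + d) * (x + real (K + d))"
    by (metis pochhammer_Suc pochhammer_rec)
  then have p': "pochhammer (x + 1) (K + d) = pochhammer x (K + d) * (x + real (K + d)) / x"
    using pos by (simp add: field_simps)
  have "(\<Sum>j\<le>Suc d. (-1) ^ j * real (Suc d choose j) / pochhammer (x + real j) K)
      = pochhammer (real K) d / pochhammer x (K + d) - pochhammer (real K) d / pochhammer (x + 1) (K + d)"
    using split unfolding 1 2 by (simp only: times_divide_eq_right mult_1_right)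
  also have "\<dots> = pochhammer (real K) d * real (K + d) / (pochhammer x (K + d) * (x + real (K + d)))"
    unfolding p' using pos by (simp add: divide_simps) (simp add: algebra_simps)
  also have "\<dots> = pochhammer (real K) (Suc d) / pochhammer x (K + Suc d)"
    by (simp add: pochhammer_Suc)
  finally show ?case .
qed

text \<open>
  Duplication: the even factorials contribute half-integer rising factorials, whose quotient is again
  a rising factorial of length \<open>N\<close>. This brings the Beta integrals below into the form to which
  \<open>alternating_sum_inverse_pochhammer\<close> applies.
\<close>

lemma choose_double_fact_eq_pochhammer:
  "real ((b + N) choose N) * fact (2 * b) / fact (2 * (b + N))
     = 1 / (fact N * 4 ^ N * pochhammer (real b + 1/2) N)"
proof -
  have "pochhammer (1/2 :: real) (b + N) = pochhammer (1/2) b * pochhammer (1/2 + real b) N"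
    by (rule pochhammer_product')
  moreover have "real ((b + N) choose N) = fact (b + N) / (fact N * fact b)"
    by (subst binomial_fact) auto
  moreover have "pochhammer (1/2 :: real) b > 0" "pochhammer (1/2 + real b) N > 0"
    by (auto intro!: pochhammer_pos)
  moreover have "(2::real) ^ (2 * k) = 4 ^ k" for k by (simp add: power_mult)
  ultimately show ?thesis unfolding fact_double
    by (simp add: divide_simps power_add add_ac mult_ac)
qed

section \<open>The generating polynomial\<close>

text \<open>
  With \<open>u = 1 - v\<close>, both sides are \<open>u^d\<close> times the coefficient of \<open>z^N\<close> in
  \<open>P = (1 + v + v^2 z)^d (1 - u z)^e\<close>. For the left side, write the two factors as
  \<open>1 + v (1 + v z)\<close> and \<open>(1 + v z) - z\<close> and expand in powers of \<open>1 + v z\<close>. For the right side, use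
  \<open>u (1 + v + v^2 z) = 1 - v^2 (1 - u z)\<close> and expand in powers of \<open>1 - u z\<close>.
\<close>

lemma rescaled_generating_identity:
  fixes v :: real and d e N :: nat
  shows "(1 - v) ^ d * (\<Sum>t\<le>d. \<Sum>r\<le>N. real (d choose t) * (-1) ^ r * real (e choose r)
             * real ((e + d - t - r) choose (N - r)) * v ^ (d + N - t - r))
       = (- (1 - v)) ^ N * (\<Sum>j\<le>d. real (d choose j) * (-1) ^ j * real ((e + j) choose N) * v ^ (2 * j))"
proof -
  define u where "u = 1 - v"
  define P where "P = [:1 + v, v\<^sup>2:] ^ d * [:1, - u:] ^ e"
  have lin: "coeff ([:1, c:] ^ k) N = real (k choose N) * c ^ N" for c :: real and k N
    by (cases "N \<le> k") (simp_all add: coeff_linear_poly_power coeff_eq_0 degree_linear_power order_le_less_trans[OF degree_power_le])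
  have expand: "(smult c Q + 1) ^ d * Q ^ e = (\<Sum>j\<le>d. smult (real (d choose j) * c ^ j) (Q ^ (e + j)))"
    for c :: real and Q :: "real poly"
    by (subst binomial_ring)
      (simp add: sum_distrib_left sum_distrib_right smult_power power_add of_nat_poly mult_ac)
  have R: "smult (u ^ d) P = (\<Sum>j\<le>d. smult (real (d choose j) * (- (v\<^sup>2)) ^ j) ([:1, - u:] ^ (e + j)))"
  proof -
    have "smult (u ^ d) P = (smult u [:1 + v, v\<^sup>2:]) ^ d * [:1, - u:] ^ e"
      by (simp add: P_def smult_power del: smult_pCons)
    also have "smult u [:1 + v, v\<^sup>2:] = smult (- (v\<^sup>2)) [:1, - u:] + 1"
      by (simp add: u_def algebra_simps power2_eq_square one_pCons)
    also have "(smult (- (v\<^sup>2)) [:1, - u:] + 1) ^ d * [:1, - u:] ^ e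
        = (\<Sum>j\<le>d. smult (real (d choose j) * (- (v\<^sup>2)) ^ j) ([:1, - u:] ^ (e + j)))"
      by (rule expand)
    finally show ?thesis .
  qed
  have L: "P = (\<Sum>t\<le>d. \<Sum>r\<le>e. smult (real (d choose t) * v ^ (d - t) * (real (e choose r) * (-1) ^ r))
      (monom 1 r * [:1, v:] ^ (e + d - t - r)))"
  proof -
    have "[:1 + v, v\<^sup>2:] = 1 + smult v [:1, v:]"
      by (simp add: one_pCons power2_eq_square)
    then have a: "[:1 + v, v\<^sup>2:] ^ d
        = (\<Sum>t\<le>d. of_nat (d choose t) * 1 ^ t * (smult v [:1, v:]) ^ (d - t))"
      by (simp only: binomial_ring)
    have "[:1, - u:] = - monom 1 1 + [:1, v:]"
      by (simp add: u_def monom_altdef)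
    then have b: "[:1, - u:] ^ e = (\<Sum>r\<le>e. of_nat (e choose r) * (- monom 1 1) ^ r * [:1, v:] ^ (e - r))"
      by (simp only: binomial_ring)
    have c: "(- monom (1::real) 1) ^ r = smult ((-1) ^ r) (monom 1 r)" for r
      by (simp add: minus_monom monom_power smult_monom)
    have pow: "[:1, v:] ^ (e + d - t - r) = [:1, v:] ^ (d - t) * [:1, v:] ^ (e - r)"
      if "t \<le> d" "r \<le> e" for t r
      using that by (simp add: add.commute flip: power_add)
    show ?thesis unfolding P_def a b c sum_product
      by (intro sum.cong refl) (simp add: pow of_nat_poly smult_power mult_ac del: smult_pCons diff_diff_left)
  qed
  have "u ^ d * coeff P N = coeff (smult (u ^ d) P) N" by simp
  also have "\<dots> = (\<Sum>j\<le>d. real (d choose j) * (- (v\<^sup>2)) ^ j * (real ((e + j) choose N) * (- u) ^ N))"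
    unfolding R by (simp add: coeff_sum lin)
  also have "\<dots> = (- u) ^ N * (\<Sum>j\<le>d. real (d choose j) * (-1) ^ j * real ((e + j) choose N) * v ^ (2 * j))"
    unfolding sum_distrib_left
    by (rule sum.cong) (simp_all add: power_minus[of "v\<^sup>2"] mult_ac flip: power_mult)
  finally have rhs: "u ^ d * coeff P N = \<dots>" .
  have inner: "(\<Sum>r\<le>e. real (e choose r) * (-1) ^ r * coeff (monom 1 r * [:1, v:] ^ (e + d - t - r)) N)
     = (\<Sum>r\<le>N. (-1) ^ r * real (e choose r) * real ((e + d - t - r) choose (N - r)) * v ^ (N - r))" for t
  proof -
    have "(\<Sum>r\<le>e. real (e choose r) * (-1) ^ r * coeff (monom 1 r * [:1, v:] ^ (e + d - t - r)) N)
      = (\<Sum>r\<in>{..e} \<inter> {..N}. (-1) ^ r * real (e choose r) * real ((e + d - t - r) choose (N - r)) * v ^ (N - r))"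
      by (rule sum.mono_neutral_cong_right) (auto simp: coeff_monom_mult lin)
    also have "\<dots> = (\<Sum>r\<le>N. (-1) ^ r * real (e choose r) * real ((e + d - t - r) choose (N - r)) * v ^ (N - r))"
      by (rule sum.mono_neutral_left) auto
    finally show ?thesis .
  qed
  have "coeff P N = (\<Sum>t\<le>d. real (d choose t) * v ^ (d - t) *
     (\<Sum>r\<le>N. (-1) ^ r * real (e choose r) * real ((e + d - t - r) choose (N - r)) * v ^ (N - r)))"
    unfolding L by (simp only: coeff_sum coeff_smult mult.assoc inner[unfolded mult.assoc] flip: sum_distrib_left)
  also have "\<dots> = (\<Sum>t\<le>d. \<Sum>r\<le>N. real (d choose t) * (-1) ^ r * real (e choose r)
             * real ((e + d - t - r) choose (N - r)) * v ^ (d + N - t - r))"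
    unfolding sum_distrib_left
  proof (intro sum.cong refl)
    fix t r assume "t \<in> {..d}" "r \<in> {..N}"
    then have "v ^ (d + N - t - r) = v ^ (d - t) * v ^ (N - r)"
      by (auto simp flip: power_add intro!: arg_cong[where f = "\<lambda>k. v ^ k"])
    then show "real (d choose t) * v ^ (d - t) *
        ((-1) ^ r * real (e choose r) * real ((e + d - t - r) choose (N - r)) * v ^ (N - r))
      = real (d choose t) * (-1) ^ r * real (e choose r)
             * real ((e + d - t - r) choose (N - r)) * v ^ (d + N - t - r)"
      by (simp only: mult_ac)
  qed
  finally show ?thesis using rhs unfolding u_def by simp
qed

section \<open>Evaluation off and on the diagonal\<close>

text \<open>
  With \<open>x = b + 1/2\<close>, each term is a constant times a combination of \<open>1/(x+j)_N\<close> and \<open>1/(x+j)_(N+1)\<close>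
  with coefficients \<open>2(N+d)\<close> and \<open>N M\<close>. The two resulting sums agree because
  \<open>N (N+1)_d = (N+d) (N)_d\<close> and the extra factor in the longer denominator is \<open>x + N + d = M/2\<close>.
  For \<open>N = 0\<close> the power \<open>(1-v)^(2N-1)\<close> behind these Beta values is not integrable, so the
  diagonal case is evaluated separately.
\<close>

lemma sum_beta_differences_eq_0:
  fixes b d N :: nat
  assumes "1 \<le> N"
  defines "M \<equiv> 2 * real (b + N + d) + 1"
  shows "(\<Sum>j\<le>d. (-1) ^ j * real (d choose j) * real ((b + j + N) choose N)
           * (M * (fact (2 * (b + j) + 1) * fact (2 * N - 1) / fact (2 * (b + j) + 1 + (2 * N - 1) + 1))
              - (M - 2 * real (N + d)) * (fact (2 * (b + j)) * fact (2 * N - 1) / fact (2 * (b + j) + (2 * N - 1) + 1))))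
         = 0"
    (is "(\<Sum>j\<le>d. ?T j) = 0")
proof -
  define x :: real where "x = real b + 1/2"
  define C :: real where "C = fact (2 * N - 1) / (fact N * 4 ^ N)"
  have x: "x > 0" by (simp add: x_def)
  have T: "?T j = C * (2 * real (N + d) * ((-1) ^ j * real (d choose j) / pochhammer (x + real j) N)
       - real N * M * ((-1) ^ j * real (d choose j) / pochhammer (x + real j) (Suc N)))" for j
  proof -
    define a where "a = b + j"
    have i: "2 * a + 1 + (2 * N - 1) + 1 = Suc (2 * (a + N))" "2 * a + (2 * N - 1) + 1 = 2 * (a + N)"
      using assms(1) by auto
    have xa: "x + real j = real a + 1/2" by (simp add: x_def a_def)
    have br: "M * (2 * real a + 1) / (2 * real (a + N) + 1) - (M - 2 * real (N + d))
       = 2 * real (N + d) - real N * M / (real a + 1/2 + real N)"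
      by (simp add: divide_simps) (simp add: algebra_simps)
    have "?T j = (-1) ^ j * real (d choose j) * fact (2 * N - 1)
        * (real ((a + N) choose N) * fact (2 * a) / fact (2 * (a + N)))
        * (M * (2 * real a + 1) / (2 * real (a + N) + 1) - (M - 2 * real (N + d)))"
      unfolding a_def[symmetric] i by (simp add: divide_simps) (simp add: algebra_simps)
    also have "\<dots> = C * (2 * real (N + d) * ((-1) ^ j * real (d choose j) / pochhammer (x + real j) N)
       - real N * M * ((-1) ^ j * real (d choose j) / pochhammer (x + real j) (Suc N)))"
      unfolding choose_double_fact_eq_pochhammer br xa C_def pochhammer_Suc
      by (simp add: algebra_simps diff_divide_distrib add_divide_distrib)
    finally show ?thesis .
  qed
  have "(\<Sum>j\<le>d. ?T j) = C * (2 * real (N + d) * (pochhammer (real N) d / pochhammer x (N + d))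
       - real N * M * (pochhammer (real (Suc N)) d / pochhammer x (Suc N + d)))"
    unfolding T sum_distrib_left[symmetric] sum_subtractf
      alternating_sum_inverse_pochhammer[OF x] by simp
  also have "real N * M * (pochhammer (real (Suc N)) d / pochhammer x (Suc N + d))
      = 2 * real (N + d) * (pochhammer (real N) d / pochhammer x (N + d))"
  proof -
    have num: "real N * pochhammer (real N + 1) d = pochhammer (real N) d * (real N + real d)"
      by (metis pochhammer_Suc pochhammer_rec)
    have den: "pochhammer x (Suc N + d) = pochhammer x (N + d) * (M / 2)"
      by (simp add: pochhammer_Suc x_def M_def field_simps)
    have "M > 0" by (simp add: M_def)
    have "real N * M * (pochhammer (real (Suc N)) d / pochhammer x (Suc N + d))
        = M * (real N * pochhammer (real N + 1) d) / pochhammer x (Suc N + d)"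
      by (simp add: add_ac mult_ac)
    also have "\<dots> = 2 * real (N + d) * (pochhammer (real N) d / pochhammer x (N + d))"
      unfolding num den using \<open>M > 0\<close> by (simp add: mult_ac)
    finally show ?thesis .
  qed
  finally show ?thesis by simp
qed

lemma has_integral_off_diagonal:
  fixes b d N :: nat
  assumes "1 \<le> N"
  defines "M \<equiv> 2 * real (b + N + d) + 1"
  shows "((\<lambda>v::real. \<Sum>j\<le>d. (-1) ^ j * real (d choose j) * real ((b + j + N) choose N)
           * (M * (v ^ (2 * (b + j) + 1) * (1 - v) ^ (2 * N - 1))
              - (M - 2 * real (N + d)) * (v ^ (2 * (b + j)) * (1 - v) ^ (2 * N - 1))))
         has_integral 0) {0..1}"
  using sum_beta_differences_eq_0[OF assms(1), where b = b and d = d] unfolding M_def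
  by (rule subst)
    (intro has_integral_sum has_integral_mult_right has_integral_diff has_integral_beta_nat finite_atMost)

text \<open>
  This is the integral that arises for \<open>n = d = Suc p\<close> and \<open>m = k + d\<close>. Multiplying the linear factor
  by the surplus factor \<open>1 + v\<close> gives the even part \<open>(2m+1) v^2 - (2k+1)\<close> and the odd part \<open>2 d v\<close>. Times
  \<open>v^(2k) (1-v^2)^p\<close>, the even part is the derivative of \<open>- (1-v^2)^d v^(2k+1)\<close>, and the odd
  part integrates termwise to a sum evaluated by \<open>alternating_sum_inverse_pochhammer\<close> with \<open>K = 1\<close>.
\<close>

lemma has_integral_diagonal:
  fixes k p :: nat
  shows "((\<lambda>v::real. v ^ (2 * k) * (1 - v) ^ p * (1 + v) ^ Suc p
             * ((2 * real (k + Suc p) + 1) * v - (2 * real k + 1)))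
          has_integral 1 / real ((k + Suc p) choose Suc p)) {0..1}"
proof -
  let ?F = "\<lambda>v::real. - ((1 - v\<^sup>2) ^ Suc p * v ^ Suc (2 * k))"
  let ?f = "\<lambda>v::real. v ^ (2 * k) * (1 - v\<^sup>2) ^ p * ((2 * real (k + Suc p) + 1) * v\<^sup>2 - (2 * real k + 1))"
  have "(?f has_integral ?F 1 - ?F 0) {0..1}"
  proof (rule fundamental_theorem_of_calculus)
    fix v :: real
    have "(?F has_real_derivative
        - (real (Suc p) * (1 - v\<^sup>2) ^ p * (- (2 * v)) * v ^ Suc (2 * k)
           + (1 - v\<^sup>2) ^ Suc p * (real (Suc (2 * k)) * v ^ (2 * k)))) (at v within {0..1})"
      by (rule derivative_eq_intros refl | simp)+
    also have "- (real (Suc p) * (1 - v\<^sup>2) ^ p * (- (2 * v)) * v ^ Suc (2 * k)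
           + (1 - v\<^sup>2) ^ Suc p * (real (Suc (2 * k)) * v ^ (2 * k))) = ?f v"
      by (simp add: algebra_simps power2_eq_square)
    finally show "(?F has_vector_derivative ?f v) (at v within {0..1})"
      by (simp add: has_real_derivative_iff_has_vector_derivative)
  qed simp
  then have exact: "(?f has_integral 0) {0..1}" by simp
  let ?g = "\<lambda>v::real. \<Sum>j\<le>p. 2 * real (Suc p) * ((-1) ^ j * real (p choose j)) * (v ^ (2 * (k + j) + 1) * (1 - v) ^ 0)"
  let ?I = "\<Sum>j\<le>p. 2 * real (Suc p) * ((-1) ^ j * real (p choose j)) * (fact (2 * (k + j) + 1) * fact 0 / fact (2 * (k + j) + 1 + 0 + 1))"
  have rest: "(?g has_integral ?I) {0..1}"
    by (intro has_integral_sum has_integral_mult_right has_integral_beta_nat) simp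
  have "?I = real (Suc p) * (\<Sum>j\<le>p. (-1) ^ j * real (p choose j) / pochhammer (real k + 1 + real j) 1)"
    unfolding sum_distrib_left
    by (rule sum.cong) (simp_all add: divide_simps, simp_all add: algebra_simps)
  also have "\<dots> = real (Suc p) * (fact p / pochhammer (real k + 1) (Suc p))"
    by (subst alternating_sum_inverse_pochhammer) (auto simp: pochhammer_fact)
  also have "pochhammer (real k + 1) (Suc p) = fact (k + Suc p) / fact k"
  proof -
    have "fact (k + Suc p) = pochhammer (1::real) k * pochhammer (1 + real k) (Suc p)"
      unfolding pochhammer_fact by (rule pochhammer_product')
    then show ?thesis by (simp add: pochhammer_fact[symmetric] add.commute)
  qed
  also have "real (Suc p) * (fact p / (fact (k + Suc p) / fact k)) = 1 / real ((k + Suc p) choose Suc p)"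
    by (subst binomial_fact) auto
  finally have I: "?I = 1 / real ((k + Suc p) choose Suc p)" .
  have eq: "?f v + ?g v = v ^ (2 * k) * (1 - v) ^ p * (1 + v) ^ Suc p
             * ((2 * real (k + Suc p) + 1) * v - (2 * real k + 1))" for v :: real
  proof -
    have sq: "(1 - v\<^sup>2) ^ p = (1 - v) ^ p * (1 + v) ^ p"
      by (simp add: power_mult_distrib[symmetric] algebra_simps power2_eq_square)
    have "(1 - v\<^sup>2) ^ p = (\<Sum>j\<le>p. (-1) ^ j * real (p choose j) * v ^ (2 * j))"
    proof -
      have "(1 - v\<^sup>2) ^ p = (- (v\<^sup>2) + 1) ^ p" by simp
      also have "\<dots> = (\<Sum>j\<le>p. real (p choose j) * (- (v\<^sup>2)) ^ j * 1 ^ (p - j))"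
        by (rule binomial_ring)
      finally show ?thesis by (simp add: power_minus[of "v\<^sup>2"] mult_ac flip: power_mult)
    qed
    then have "?g v = 2 * real (Suc p) * v ^ (2 * k + 1) * (1 - v\<^sup>2) ^ p"
      by (simp add: sum_distrib_left power_add mult_ac del: of_nat_Suc)
    then show ?thesis unfolding sq
      by (simp add: algebra_simps power2_eq_square)
  qed
  have "((\<lambda>v. ?f v + ?g v) has_integral 0 + ?I) {0..1}"
    by (intro has_integral_add exact rest)
  then show ?thesis unfolding eq I by simp
qed

section \<open>Collapsing the double sum\<close>

text \<open>
  Both sides count the ways to split \<open>m\<close> objects into blocks of sizes \<open>t\<close>, \<open>r\<close>, \<open>d-t\<close> and
  \<open>m-d-r\<close>.
\<close>

lemma choose_triple_product:
  fixes m d t r :: nat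
  assumes "t \<le> d" "d \<le> m" "r \<le> m - d"
  shows "real (m choose (t + r)) * real ((t + r) choose t) * real ((m - (t + r)) choose (d - t))
       = real (m choose d) * real (d choose t) * real ((m - d) choose r)"
proof -
  obtain u where d: "d = t + u" using assms(1) le_Suc_ex by blast
  obtain w where "m - d = r + w" using assms(3) le_Suc_ex by blast
  then have m: "m = t + u + (r + w)" using assms(2) d by simp
  have [simp]: "m - (t + r) = u + w" "m - d = r + w" "d - t = u" using m d by auto
  have 1: "real (m choose (t + r)) = fact m / (fact (t + r) * fact (u + w))"
    using m by (subst binomial_fact) auto
  have 2: "real ((t + r) choose t) = fact (t + r) / (fact t * fact r)"
    by (subst binomial_fact) auto
  have 3: "real ((u + w) choose u) = fact (u + w) / (fact u * fact w)"
    by (subst binomial_fact) auto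
  have 4: "real (m choose d) = fact m / (fact d * fact (r + w))"
    using m d by (subst binomial_fact) auto
  have 5: "real (d choose t) = fact d / (fact t * fact u)"
    using d by (subst binomial_fact) auto
  have 6: "real ((r + w) choose r) = fact (r + w) / (fact r * fact w)"
    by (subst binomial_fact) auto
  show ?thesis by (simp add: 1 2 3 4 5 6)
qed

theorem theorem8p1:
  fixes m n d :: nat
  assumes "m \<ge> n" and "n \<ge> d"
  shows "(\<Sum>s = 0..n. \<Sum>t = 0..d.
            (-1) ^ (s + t) * real (m choose s) * real (s choose t)
            * inverse (real ((2 * m - s) choose n))
            * real ((m - s) choose (d - t + m - n)) * real ((m - s) choose (d - t))
            * (real (2 * m - 2 * s + 1) / real (2 * m - s + 1)))
         = (if n = d then 1 else 0)"
proof (cases "n = 0")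
  case True
  then show ?thesis using assms by (simp add: divide_simps)
next
  case False
  define N where "N = n - d"
  have n: "n = d + N" using assms by (simp add: N_def)
  define W where "W s = inverse (real ((2 * m - s) choose n))
            * (real (2 * m - 2 * s + 1) / real (2 * m - s + 1))" for s
  define c where "c t r = real (d choose t) * (-1) ^ r * real ((m - d) choose r)
             * real ((m - t - r) choose (N - r))" for t r
  define F where "F s t = (-1) ^ (s + t) * real (m choose s) * real (s choose t)
            * inverse (real ((2 * m - s) choose n))
            * real ((m - s) choose (d - t + m - n)) * real ((m - s) choose (d - t))
            * (real (2 * m - 2 * s + 1) / real (2 * m - s + 1))" for s t
  define q where "q v = (2 * real m + 1) * v - (2 * real m + 1 - 2 * real n)" for v
  have Fc: "F (t + r) t = real (m choose d) * (c t r * W (t + r))" if "t \<le> d" "r \<le> N" for t r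
  proof -
    have "(m - (t + r)) choose (d - t + m - n) = (m - t - r) choose (N - r)"
      using that assms n by (subst binomial_symmetric) (auto intro!: arg_cong2[where f = binomial])
    moreover have "(-1) ^ (t + r + t) = ((-1) ^ r :: real)" by (simp add: power_add mult_ac flip: power_mult_distrib)
    moreover have "real (m choose (t + r)) * real ((t + r) choose t) * real ((m - (t + r)) choose (d - t))
       = real (m choose d) * real (d choose t) * real ((m - d) choose r)"
      using that assms n by (intro choose_triple_product) auto
    ultimately show ?thesis unfolding F_def c_def W_def by (simp add: mult_ac)
  qed
  have "(\<Sum>s = 0..n. \<Sum>t = 0..d. F s t) = (\<Sum>t = 0..d. \<Sum>s = 0..n. F s t)"
    by (rule sum.swap)
  \<comment> \<open>The summand vanishes unless \<open>t \<le> s \<le> t + N\<close>, and this range lies inside \<open>{0..n}\<close>.\<close>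
  also have "\<dots> = (\<Sum>t\<le>d. \<Sum>r\<le>N. F (t + r) t)"
  proof (rule sum.cong)
    fix t assume "t \<in> {..d}"
    then have t: "t \<le> d" by simp
    have "(\<Sum>s = 0..n. F s t) = (\<Sum>s\<in>(\<lambda>r. t + r) ` {..N}. F s t)"
    proof (rule sum.mono_neutral_right)
      show "\<forall>s\<in>{0..n} - (\<lambda>r. t + r) ` {..N}. F s t = 0"
      proof
        fix s assume s: "s \<in> {0..n} - (\<lambda>r. t + r) ` {..N}"
        have "s < t \<or> t + N < s"
        proof (rule ccontr)
          assume "\<not> (s < t \<or> t + N < s)"
          then have "s = t + (s - t)" "s - t \<in> {..N}" by auto
          then show False using s by blast
        qed
        then show "F s t = 0"
        proof
          assume "t + N < s"
          then have "m - s < d - t + m - n" using s t assms n by auto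
          then show ?thesis by (simp add: F_def)
        qed (simp add: F_def)
      qed
    qed (use t n in auto)
    also have "\<dots> = (\<Sum>r\<le>N. F (t + r) t)" by (subst sum.reindex) auto
    finally show "(\<Sum>s = 0..n. F s t) = (\<Sum>r\<le>N. F (t + r) t)" .
  qed auto
  also have "\<dots> = real (m choose d) * (\<Sum>t\<le>d. \<Sum>r\<le>N. c t r * W (t + r))"
    unfolding sum_distrib_left by (intro sum.cong refl Fc) auto
  finally have S: "(\<Sum>s = 0..n. \<Sum>t = 0..d. F s t) = \<dots>" .
  \<comment> \<open>Splitting off the common power \<open>v^(2(m-n))\<close> leaves \<open>v^(n-s)\<close>, whose exponent is the one in the generating identity.\<close>
  let ?G = "\<lambda>v::real. \<Sum>t\<le>d. \<Sum>r\<le>N. c t r * v ^ (d + N - t - r)"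
  have "((\<lambda>v::real. \<Sum>t\<le>d. \<Sum>r\<le>N. c t r * (v ^ (2 * m - n - (t + r)) * (1 - v) ^ (n - 1) * q v))
      has_integral (\<Sum>t\<le>d. \<Sum>r\<le>N. c t r * W (t + r))) {0..1}"
    unfolding W_def q_def using False assms n
    by (intro has_integral_sum has_integral_mult_right has_integral_weight) auto
  also have "(\<lambda>v::real. \<Sum>t\<le>d. \<Sum>r\<le>N. c t r * (v ^ (2 * m - n - (t + r)) * (1 - v) ^ (n - 1) * q v))
      = (\<lambda>v. v ^ (2 * (m - n)) * (1 - v) ^ (n - 1) * q v * ?G v)"
  proof -
    have "v ^ (2 * m - n - (t + r)) = v ^ (2 * (m - n)) * v ^ (d + N - t - r)"
      if "t \<le> d" "r \<le> N" for v :: real and t r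
      using that assms n by (subst power_add[symmetric]) (auto intro!: arg_cong[where f = "\<lambda>k. v ^ k"])
    then show ?thesis unfolding sum_distrib_left
      by (intro ext sum.cong refl) (simp add: mult_ac)
  qed
  finally have int: "((\<lambda>v. v ^ (2 * (m - n)) * (1 - v) ^ (n - 1) * q v * ?G v)
      has_integral (\<Sum>t\<le>d. \<Sum>r\<le>N. c t r * W (t + r))) {0..1}" .
  have "(\<Sum>t\<le>d. \<Sum>r\<le>N. c t r * W (t + r)) = (if n = d then 1 / real (m choose d) else 0)"
  proof (cases "n = d")
    case True
    then have N: "N = 0" by (simp add: N_def)
    obtain p where p: "d = Suc p" using False True by (cases d) auto
    have m: "m = (m - d) + Suc p" using p assms True by simp
    have G: "?G v = (1 + v) ^ Suc p" for v :: real
      unfolding p[symmetric] by (subst binomial_ring) (simp add: c_def N)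
    have q: "q v = (2 * real (m - d + Suc p) + 1) * v - (2 * real (m - d) + 1)" for v
      unfolding q_def m[symmetric] using assms True by (simp add: of_nat_diff)
    have "((\<lambda>v. v ^ (2 * (m - n)) * (1 - v) ^ (n - 1) * q v * ?G v)
        has_integral 1 / real ((m - d + Suc p) choose Suc p)) {0..1}"
      using has_integral_diagonal[of "m - d" p] unfolding G q
      by (simp add: True p mult_ac)
    then show ?thesis using has_integral_unique[OF int] True m p by simp
  next
    case neq: False
    then have N: "1 \<le> N" using assms by (simp add: N_def)
    define b where "b = m - n"
    have m: "m = b + N + d" using assms n by (simp add: b_def)
    have int': "((\<lambda>v::real. (-1) ^ N * (\<Sum>j\<le>d. (-1) ^ j * real (d choose j) * real ((b + j + N) choose N)
         * ((2 * real m + 1) * (v ^ (2 * (b + j) + 1) * (1 - v) ^ (2 * N - 1))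
          - (2 * real m + 1 - 2 * real (N + d)) * (v ^ (2 * (b + j)) * (1 - v) ^ (2 * N - 1)))))
       has_integral (-1) ^ N * 0) {0..1}"
      unfolding m by (intro has_integral_mult_right has_integral_off_diagonal N)
    have "v ^ (2 * (m - n)) * (1 - v) ^ (n - 1) * q v * ?G v
        = (-1) ^ N * (\<Sum>j\<le>d. (-1) ^ j * real (d choose j) * real ((b + j + N) choose N)
         * ((2 * real m + 1) * (v ^ (2 * (b + j) + 1) * (1 - v) ^ (2 * N - 1))
          - (2 * real m + 1 - 2 * real (N + d)) * (v ^ (2 * (b + j)) * (1 - v) ^ (2 * N - 1))))" for v :: real
    proof -
      have g: "(1 - v) ^ d * ?G v = (-1) ^ N * (1 - v) ^ N *
          (\<Sum>j\<le>d. real (d choose j) * (-1) ^ j * real ((b + j + N) choose N) * v ^ (2 * j))"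
        using power_minus[of "1 - v" N] rescaled_generating_identity[where v = v and d = d and N = N and e = "m - d"] assms n
        unfolding c_def by (simp add: m add_ac)
      have split: "v ^ (2 * b) * v ^ (2 * j) * (1 - v) ^ (2 * N - 1) * q v
          = (2 * real m + 1) * (v ^ (2 * (b + j) + 1) * (1 - v) ^ (2 * N - 1))
          - (2 * real m + 1 - 2 * real (N + d)) * (v ^ (2 * (b + j)) * (1 - v) ^ (2 * N - 1))" for j
        unfolding q_def n by (simp add: power_add algebra_simps)
      \<comment> \<open>Of the \<open>n - 1\<close> factors \<open>1 - v\<close>, \<open>d\<close> are consumed by the generating identity; the other \<open>N - 1\<close> join the \<open>N\<close> that it returns.\<close>
      have "n - 1 = (N - 1) + d" using N n by simp
      then have "v ^ (2 * (m - n)) * (1 - v) ^ (n - 1) * q v * ?G v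
        = v ^ (2 * b) * (1 - v) ^ (N - 1) * q v * ((1 - v) ^ d * ?G v)"
        by (simp only: power_add b_def mult_ac)
      also have "\<dots> = (-1) ^ N * (\<Sum>j\<le>d. (-1) ^ j * real (d choose j) * real ((b + j + N) choose N)
          * (v ^ (2 * b) * v ^ (2 * j) * ((1 - v) ^ (N - 1) * (1 - v) ^ N) * q v))"
        unfolding g by (simp add: sum_distrib_left mult_ac)
      also have "(1 - v) ^ (N - 1) * (1 - v) ^ N = (1 - v) ^ (2 * N - 1)"
        using N by (simp flip: power_add) (simp add: mult_2)
      finally show ?thesis by (simp only: split)
    qed
    then show ?thesis using has_integral_unique[OF int] int' neq by simp
  qed
  then show ?thesis using S assms unfolding F_def by simp
qed

end
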